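(* Let $V$ be a finite set and $\sigma,\beta\in\mathbb R$. Let $H$ be the differential operator mapping real analytic functions $g:\mathbb R\to\mathbb R$ into functions $Hg:\mathbb N\to\mathbb R$ given by $$Hg(n)=\left[\frac{d^n}{dz^n}\right]_{z=0}\left(e^zg(z)\right),\qquad n\in\mathbb N,$$ and let $G$ be the operator mapping functions $f:\mathbb N\to\mathbb R$ into functions $Gf:\mathbb R\to\mathbb R$ given by $Gf(z)=\sum_{n=0}^\infty f(n)\frac{z^n}{n!}e^{-z}$, $z\in\mathbb R$. Then $H$ is the inverse operator of $G$, namely, for all real analytic $g:\mathbb R\to\mathbb R$ and for all $f:\mathbb N\to\mathbb R$ such that $Gf:\mathbb R\to\mathbb R$ is real analytic, $$GHg(z)=g(z),\quad z\in\mathbb R,\qquad HGf(n)=f(n),\quad n\in\mathbb N.$$ Moreover, the tensorized operator $H^\otimes=\otimes_{x\in V}H^{(x)}$ is an intertwiner for $L^{\sigma,\beta}$ and $\mathscr L^{\sigma,\beta}$, i.e. for all real analytic $g:\mathbb R^V\to\mathbb R$, $$L^{\sigma,\beta}H^\otimes g(n)=H^\otimes\mathscr L^{\sigma,\beta}g(n),\qquad n\in\mathbb N^V.$$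
   Context: Let $p:V\times V\to[0,\infty)$ with $p(x,x)=0$ for all $x\in V$, and irreducible (for all $x,y\in V$ there exist $x_1=x,\dots,x_m=y$ with $\prod_{l=1}^{m-1}p(x_l,x_{l+1})>0$). On functions $f:\mathbb N^V\to\mathbb R$, $L^{\sigma,\beta}f(\eta)=\sum_{x,y\in V}p(x,y)L^{\sigma,\beta}_{x,y}f(\eta)$ with $$L^{\sigma,\beta}_{x,y}f(\eta)=\eta_x(\beta+\sigma\eta_y)(f(\eta^{x,y})-f(\eta))+\eta_y(\beta+\sigma\eta_x)(f(\eta^{y,x})-f(\eta)),$$ where $\eta^{x,y}$ is $\eta$ with one particle moved from $x$ to $y$ (a term with prefactor $0$ vanishes). On real analytic functions $f:\mathbb R^V\to\mathbb R$, $\mathscr L^{\sigma,\beta}f(z)=\sum_{x,y\in V}p(x,y)\mathscr L^{\sigma,\beta}_{x,y}f(z)$ with $$\mathscr L^{\sigma,\beta}_{x,y}f(z)=\left(-\beta(z_x-z_y)(\partial_x-\partial_y)+\sigma z_xz_y(\partial_x-\partial_y)^2\right)f(z).$$ The tensorized operator $H^\otimes$ applies $H$ in each variable $z_x$, $x\in V$: $H^\otimes g(n)=\left[\prod_{x\in V}\partial_{z_x}^{n_x}\right]_{z=0}\left(e^{\sum_{x\in V}z_x}g(z)\right)$.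
   Formalization: GHg(z)=g(z) is claimed for real analytic g only at those z where the series GHg(z) converges, and at all z if g has an everywhere convergent power series at 0; as stated it fails for g(z)=1/(1+z²), where the series diverges for |z|>1. *)

theory Defs
  imports "HOL-Analysis.Analysis"
begin

text \<open>The finite set \<open>V\<close> is the type \<^typ>\<open>'v\<close> of class \<open>finite\<close>; \<open>\<nat>\<^sup>V\<close> is \<^typ>\<open>'v \<Rightarrow> nat\<close>
  and \<open>\<real>\<^sup>V\<close> is \<^typ>\<open>real ^ 'v\<close>.\<close>


section \<open>Real analytic functions\<close>

definition real_analytic :: "(real \<Rightarrow> real) \<Rightarrow> bool" where
  "real_analytic g \<longleftrightarrow>
     (\<forall>w. \<exists>r>0. \<exists>a :: nat \<Rightarrow> real. \<forall>z. \<bar>z - w\<bar> < r \<longrightarrow> (\<lambda>n. a n * (z - w) ^ n) sums g z)"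

text \<open>The stronger property that a single power series, centred at 0, represents \<open>g\<close> on the whole
  line. The function \<open>1 / (1 + z\<^sup>2)\<close> is real analytic but not of this kind.\<close>

definition real_entire :: "(real \<Rightarrow> real) \<Rightarrow> bool" where
  "real_entire g \<longleftrightarrow> (\<exists>a :: nat \<Rightarrow> real. \<forall>z. (\<lambda>n. a n * z ^ n) sums g z)"

definition real_analytic_vec :: "(real ^ 'v \<Rightarrow> real) \<Rightarrow> bool" where
  "real_analytic_vec g \<longleftrightarrow>
     (\<forall>w. \<exists>r>0. \<exists>a :: ('v \<Rightarrow> nat) \<Rightarrow> real. \<forall>z. dist z w < r \<longrightarrow>
        ((\<lambda>k. a k * (\<Prod>x\<in>UNIV. (z $ x - w $ x) ^ k x)) has_sum g z) UNIV)"


section \<open>The operators \<open>H\<close> and \<open>G\<close>\<close>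

definition H_op :: "(real \<Rightarrow> real) \<Rightarrow> nat \<Rightarrow> real" where
  "H_op g n = (deriv ^^ n) (\<lambda>z. exp z * g z) 0"

definition G_term :: "(nat \<Rightarrow> real) \<Rightarrow> real \<Rightarrow> nat \<Rightarrow> real" where
  "G_term f z n = f n * (z ^ n / fact n) * exp (- z)"

text \<open>\<open>G_op f z\<close> is meaningful only where \<open>summable (G_term f z)\<close> holds.\<close>

definition G_op :: "(nat \<Rightarrow> real) \<Rightarrow> real \<Rightarrow> real" where
  "G_op f z = (\<Sum>n. G_term f z n)"


section \<open>Partial derivatives and the tensorized operator\<close>

definition partial :: "'v::finite \<Rightarrow> (real ^ 'v \<Rightarrow> real) \<Rightarrow> real ^ 'v \<Rightarrow> real" where
  "partial x f z = deriv (\<lambda>t. f (z + t *\<^sub>R axis x 1)) 0"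

text \<open>The product \<open>\<Prod>\<^bsub>x\<in>V\<^esub> \<partial>\<^sub>x\<^bsup>n x\<^esup>\<close> is the composition along an arbitrary enumeration of \<open>V\<close>; on
  real analytic functions partial derivatives commute, so the enumeration is irrelevant.\<close>

definition enumeration :: "'v::finite list" where
  "enumeration = (SOME xs. distinct xs \<and> set xs = UNIV)"

definition partials :: "('v::finite \<Rightarrow> nat) \<Rightarrow> (real ^ 'v \<Rightarrow> real) \<Rightarrow> real ^ 'v \<Rightarrow> real" where
  "partials n = foldr (\<lambda>x. partial x ^^ n x) enumeration"

definition H_tensor :: "(real ^ 'v::finite \<Rightarrow> real) \<Rightarrow> ('v \<Rightarrow> nat) \<Rightarrow> real" where
  "H_tensor g n = partials n (\<lambda>z. exp (\<Sum>x\<in>UNIV. z $ x) * g z) 0"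


section \<open>The two generators\<close>

text \<open>Connectivity of \<open>V\<close> through chains \<open>x\<^sub>1 = x, \<dots>, x\<^sub>m = y\<close>.\<close>

definition irreducible_rates :: "('v \<Rightarrow> 'v \<Rightarrow> real) \<Rightarrow> bool" where
  "irreducible_rates p \<longleftrightarrow>
     (\<forall>x y. \<exists>xs. xs \<noteq> [] \<and> hd xs = x \<and> last xs = y \<and>
        (\<Prod>l<length xs - 1. p (xs ! l) (xs ! Suc l)) > 0)"

text \<open>The natural-number subtraction truncates only for \<open>\<eta> x = 0\<close>, where \<open>move\<close> is multiplied
  by 0 below.\<close>

definition move :: "'v \<Rightarrow> 'v \<Rightarrow> ('v \<Rightarrow> nat) \<Rightarrow> 'v \<Rightarrow> nat" where
  "move x y \<eta> = (let \<eta>' = \<eta>(x := \<eta> x - 1) in \<eta>'(y := \<eta>' y + 1))"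

definition L_pair ::
  "real \<Rightarrow> real \<Rightarrow> 'v \<Rightarrow> 'v \<Rightarrow> (('v \<Rightarrow> nat) \<Rightarrow> real) \<Rightarrow> ('v \<Rightarrow> nat) \<Rightarrow> real" where
  "L_pair \<sigma> \<beta> x y f \<eta> =
     real (\<eta> x) * (\<beta> + \<sigma> * real (\<eta> y)) * (f (move x y \<eta>) - f \<eta>) +
     real (\<eta> y) * (\<beta> + \<sigma> * real (\<eta> x)) * (f (move y x \<eta>) - f \<eta>)"

definition L_gen ::
  "('v::finite \<Rightarrow> 'v \<Rightarrow> real) \<Rightarrow> real \<Rightarrow> real \<Rightarrow> (('v \<Rightarrow> nat) \<Rightarrow> real) \<Rightarrow> ('v \<Rightarrow> nat) \<Rightarrow> real" where
  "L_gen p \<sigma> \<beta> f \<eta> = (\<Sum>x\<in>UNIV. \<Sum>y\<in>UNIV. p x y * L_pair \<sigma> \<beta> x y f \<eta>)"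

definition partial_diff ::
  "'v::finite \<Rightarrow> 'v \<Rightarrow> (real ^ 'v \<Rightarrow> real) \<Rightarrow> real ^ 'v \<Rightarrow> real" where
  "partial_diff x y f z = partial x f z - partial y f z"

definition scrL_pair ::
  "real \<Rightarrow> real \<Rightarrow> 'v::finite \<Rightarrow> 'v \<Rightarrow> (real ^ 'v \<Rightarrow> real) \<Rightarrow> real ^ 'v \<Rightarrow> real" where
  "scrL_pair \<sigma> \<beta> x y f z =
     - \<beta> * (z $ x - z $ y) * partial_diff x y f z +
     \<sigma> * (z $ x) * (z $ y) * (partial_diff x y ^^ 2) f z"

definition scrL_gen ::
  "('v::finite \<Rightarrow> 'v \<Rightarrow> real) \<Rightarrow> real \<Rightarrow> real \<Rightarrow> (real ^ 'v \<Rightarrow> real) \<Rightarrow> real ^ 'v \<Rightarrow> real" where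
  "scrL_gen p \<sigma> \<beta> f z = (\<Sum>x\<in>UNIV. \<Sum>y\<in>UNIV. p x y * scrL_pair \<sigma> \<beta> x y f z)"

end

theory Submission
  imports Defs "HOL-Complex_Analysis.Laurent_Convergence"
begin

text \<open>
  \<open>H g n / n!\<close> is the \<open>n\<close>-th Taylor coefficient of \<open>exp z * g z\<close> at \<open>0\<close>, while \<open>exp z * G f z\<close> is the power
  series with coefficients \<open>f n / n!\<close>. So \<open>H (G f) = f\<close> is uniqueness of coefficients. For \<open>G (H g) = g\<close>
  at a point \<open>z\<close> where the series converges, its sum and \<open>exp z * g z\<close> agree on \<open>(-\<bar>z\<bar>, \<bar>z\<bar>)\<close> by the
  identity theorem, and at the possible boundary point \<open>z\<close> by Abel's limit theorem.

  For the intertwining, the factor \<open>exp (\<Sum>x. z $ x)\<close> commutes with \<open>\<partial>\<^sub>x - \<partial>\<^sub>y\<close>, the only way derivatives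
  enter the differential generator. The generator therefore acts on the Taylor coefficients
  of \<open>exp (\<Sum>x. z $ x) * g z\<close>, where multiplication by \<open>z $ x\<close> and \<open>\<partial>\<^sub>x\<close> are index shifts, and the claim
  becomes an identity between finitely many coefficients.
\<close>

section \<open>Real analyticity and one-variable power series\<close>

lemma has_fps_expansion_of_sums:
  fixes f :: "'a::{banach, real_normed_field} \<Rightarrow> 'a"
  assumes "r > 0" "\<And>z. norm z < r \<Longrightarrow> (\<lambda>n. a n * z ^ n) sums f z"
  shows "f has_fps_expansion Abs_fps a"
proof -
  have "summable (\<lambda>n. a n * of_real (r / 2) ^ n)"
    using assms(2)[of "of_real (r/2)"] \<open>r > 0\<close> by (auto simp: sums_iff)
  from conv_radius_geI[OF this] have "ereal (r / 2) \<le> conv_radius a"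
    using \<open>r > 0\<close> by simp
  hence "conv_radius a > 0"
    using \<open>r > 0\<close> by (meson ereal_less(2) half_gt_zero less_le_trans)
  moreover have "\<forall>\<^sub>F z in nhds 0. z \<in> ball 0 r"
    using \<open>r > 0\<close> by (intro eventually_nhds_in_open) auto
  hence "\<forall>\<^sub>F z in nhds 0. eval_fps (Abs_fps a) z = f z"
    by eventually_elim (use assms(2) in \<open>auto simp: eval_fps_def sums_iff\<close>)
  ultimately show ?thesis
    by (auto simp: has_fps_expansion_def fps_conv_radius_def)
qed

lemma has_fps_expansion_sums:
  fixes f :: "'a::{banach, real_normed_field} \<Rightarrow> 'a"
  assumes "f has_fps_expansion F"
  obtains r where "r > 0" "\<And>z. norm z < r \<Longrightarrow> (\<lambda>n. fps_nth F n * z ^ n) sums f z"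
proof -
  have "\<forall>\<^sub>F z in nhds 0. z \<in> eball 0 (fps_conv_radius F)"
    using assms by (intro eventually_nhds_in_open) (auto simp: has_fps_expansion_def zero_ereal_def)
  moreover have "\<forall>\<^sub>F z in nhds 0. eval_fps F z = f z"
    using assms by (auto simp: has_fps_expansion_def)
  ultimately have "\<forall>\<^sub>F z in nhds 0. (\<lambda>n. fps_nth F n * z ^ n) sums f z"
    by eventually_elim (use sums_eval_fps in force)
  thus ?thesis
    using that unfolding eventually_nhds_metric dist_norm by auto
qed

lemma has_fps_expansion_higher_deriv:
  fixes f :: "'a::{banach, real_normed_field} \<Rightarrow> 'a"
  assumes "f has_fps_expansion F"
  shows "(deriv ^^ n) f 0 = fact n * fps_nth F n"
  using assms
proof (induction n arbitrary: f F)
  case 0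
  then show ?case by (simp add: has_fps_expansion_imp_0_eq_fps_nth_0)
next
  case (Suc n)
  have "(deriv ^^ Suc n) f 0 = (deriv ^^ n) (deriv f) 0"
    by (simp add: funpow_swap1)
  also have "\<dots> = fact n * fps_nth (fps_deriv F) n"
    using Suc.IH[OF has_fps_expansion_deriv[OF Suc.prems]] .
  also have "\<dots> = fact (Suc n) * fps_nth F (Suc n)"
    by (simp add: algebra_simps)
  finally show ?case .
qed

lemma fps_expansion_eventually_zero_or_nonzero:
  fixes f :: "'a::{banach, real_normed_field} \<Rightarrow> 'a"
  assumes "f has_fps_expansion F"
  shows "(\<forall>\<^sub>F t in nhds 0. f t = 0) \<or> (\<forall>\<^sub>F t in at 0. f t \<noteq> 0)"
proof (cases "F = 0")
  case True
  then show ?thesis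
    using assms by (auto simp: has_fps_expansion_def elim: eventually_mono)
next
  case False
  obtain r where r: "r > 0" "\<And>z. norm z < r \<Longrightarrow> (\<lambda>n. fps_nth F n * z ^ n) sums f z"
    using has_fps_expansion_sums[OF assms] by blast
  have f0: "f 0 = fps_nth F 0"
    using has_fps_expansion_imp_0_eq_fps_nth_0[OF assms] .
  have "\<forall>\<^sub>F t in at 0. f t \<noteq> 0"
  proof (cases "f 0 = 0")
    case True
    obtain m where m: "fps_nth F m \<noteq> 0"
      using False by (auto simp: fps_eq_iff)
    hence "m > 0" using True f0 by (metis gr0I)
    then obtain s where "0 < s" "\<And>z. z \<in> cball 0 s - {0} \<Longrightarrow> f z \<noteq> 0"
      using powser_0_nonzero[of r 0 "fps_nth F" f m] r True m by auto
    thus ?thesis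
      by (auto simp: eventually_at intro!: exI[of _ s])
  next
    case False
    have "f \<midarrow>0\<rightarrow> f 0"
      using has_fps_expansion_imp_continuous[OF assms, of UNIV] by (simp add: continuous_at)
    thus ?thesis using False by (rule tendsto_imp_eventually_ne)
  qed
  thus ?thesis ..
qed

definition analytic_near :: "(real \<Rightarrow> real) \<Rightarrow> real \<Rightarrow> bool" where
  "analytic_near f w \<longleftrightarrow> (\<exists>F. (\<lambda>t. f (w + t)) has_fps_expansion F)"

lemma analytic_nearI:
  assumes "r > 0" "\<And>z. \<bar>z - w\<bar> < r \<Longrightarrow> (\<lambda>n. a n * (z - w) ^ n) sums f z"
  shows "analytic_near f w"
  unfolding analytic_near_def
proof
  show "(\<lambda>t. f (w + t)) has_fps_expansion Abs_fps a"
    using assms(1)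
  proof (rule has_fps_expansion_of_sums)
    show "(\<lambda>n. a n * t ^ n) sums f (w + t)" if "norm t < r" for t
      using assms(2)[of "w + t"] that by simp
  qed
qed

lemma real_analytic_imp_analytic_near:
  assumes "real_analytic g"
  shows "analytic_near g w"
proof -
  obtain r a where "r > 0" "\<And>z. \<bar>z - w\<bar> < r \<Longrightarrow> (\<lambda>n. a n * (z - w) ^ n) sums g z"
    using assms unfolding real_analytic_def by blast
  thus ?thesis by (rule analytic_nearI)
qed

lemma analytic_near_exp_mult:
  assumes "analytic_near g w"
  shows "analytic_near (\<lambda>z. exp z * g z) w"
proof -
  obtain F where "(\<lambda>t. g (w + t)) has_fps_expansion F"
    using assms by (auto simp: analytic_near_def)
  hence "(\<lambda>t. (exp w * exp t) * g (w + t)) has_fps_expansion (fps_const (exp w) * fps_exp 1) * F"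
    by (intro fps_expansion_intros)
  thus ?thesis by (auto simp: analytic_near_def exp_add)
qed

lemma analytic_near_diff:
  assumes "analytic_near f w" "analytic_near g w"
  shows "analytic_near (\<lambda>z. f z - g z) w"
proof -
  obtain F G where "(\<lambda>t. f (w + t)) has_fps_expansion F" "(\<lambda>t. g (w + t)) has_fps_expansion G"
    using assms by (auto simp: analytic_near_def)
  hence "(\<lambda>t. f (w + t) - g (w + t)) has_fps_expansion F - G"
    by (intro fps_expansion_intros)
  thus ?thesis by (auto simp: analytic_near_def)
qed

lemma analytic_near_imp_isCont:
  assumes "analytic_near f w"
  shows "isCont f w"
proof -
  obtain F where "(\<lambda>t. f (w + t)) has_fps_expansion F"
    using assms by (auto simp: analytic_near_def)
  hence "isCont (\<lambda>t. f (w + t)) 0"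
    using has_fps_expansion_imp_continuous[of _ _ UNIV] by blast
  thus ?thesis by (simp add: isCont_iff continuous_at)
qed

text \<open>A real power series is re-expanded about another point as the real part of the Taylor series
  of its complex extension.\<close>

lemma analytic_near_powser:
  fixes c :: "nat \<Rightarrow> real"
  assumes "summable (\<lambda>n. c n * R ^ n)" "\<bar>w\<bar> < \<bar>R\<bar>"
  shows "analytic_near (\<lambda>x. \<Sum>n. c n * x ^ n) w"
proof -
  define C :: "complex fps" where "C = Abs_fps (\<lambda>n. of_real (c n))"
  have "summable (\<lambda>n. complex_of_real (c n) * of_real R ^ n)"
    using summable_of_real[OF assms(1), where 'a = complex] by simp
  from conv_radius_geI[OF this] have R: "ereal \<bar>R\<bar> \<le> fps_conv_radius C"
    by (simp add: C_def fps_conv_radius_def)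
  have inR: "norm z < fps_conv_radius C" if "norm z < \<bar>R\<bar>" for z :: complex
    using R that by (meson ereal_less_eq(3) less_ereal.simps(1) less_le_trans)
  define d where "d = \<bar>R\<bar> - \<bar>w\<bar>"
  have "d > 0" using assms by (simp add: d_def)
  have sub: "norm z < \<bar>R\<bar>" if "z \<in> ball (complex_of_real w) d" for z
  proof -
    have "norm z \<le> norm (complex_of_real w) + norm (z - of_real w)"
      by (metis add.commute diff_add_cancel norm_triangle_ineq)
    thus ?thesis using that by (simp add: d_def dist_norm norm_minus_commute)
  qed
  have "eval_fps C holomorphic_on ball (of_real w) d"
    by (intro holomorphic_on_eval_fps) (auto intro!: inR sub)
  hence *: "(\<lambda>n. (deriv ^^ n) (eval_fps C) w / fact n * (z - w) ^ n) sums eval_fps C z"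
    if "z \<in> ball (complex_of_real w) d" for z
    using holomorphic_power_series that by blast
  show ?thesis
  proof (rule analytic_nearI[of d])
    fix x :: real assume x: "\<bar>x - w\<bar> < d"
    have xb: "complex_of_real x \<in> ball (of_real w) d"
      using x by (simp add: dist_norm norm_minus_commute flip: of_real_diff)
    have "(\<lambda>n. fps_nth C n * of_real x ^ n) sums eval_fps C (of_real x)"
      by (intro sums_eval_fps inR sub xb)
    hence "(\<lambda>n. complex_of_real (c n * x ^ n)) sums eval_fps C (of_real x)"
      by (simp add: C_def)
    hence "(\<lambda>n. c n * x ^ n) sums Re (eval_fps C (of_real x))"
      using sums_Re by fastforce
    hence e: "Re (eval_fps C (of_real x)) = (\<Sum>n. c n * x ^ n)"
      by (simp add: sums_iff)
    have "(\<lambda>n. Re ((deriv ^^ n) (eval_fps C) w / fact n * (complex_of_real x - of_real w) ^ n)) sums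
            Re (eval_fps C (of_real x))"
      by (rule sums_Re[OF *[OF xb]])
    moreover have Re: "Re (u * (complex_of_real x - of_real w) ^ n) = Re u * (x - w) ^ n" for u n
      by (simp flip: of_real_diff of_real_power)
    ultimately show "(\<lambda>n. Re ((deriv ^^ n) (eval_fps C) w / fact n) * (x - w) ^ n) sums
        (\<Sum>n. c n * x ^ n)"
      by (simp only: e Re)
  qed fact
qed

lemma analytic_near_identity:
  assumes "open I" "connected I" "\<And>w. w \<in> I \<Longrightarrow> analytic_near D w"
    and "a \<in> I" "\<forall>\<^sub>F z in nhds a. D z = 0" "z \<in> I"
  shows "D z = 0"
proof -
  let ?Z = "{w. \<forall>\<^sub>F z in nhds w. D z = 0}"
  have "open ?Z"
  proof (subst open_subopen, rule ballI)
    fix w assume "w \<in> ?Z"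
    hence "\<forall>\<^sub>F v in nhds w. v \<in> ?Z" by (simp add: eventually_eventually)
    thus "\<exists>T. open T \<and> w \<in> T \<and> T \<subseteq> ?Z"
      unfolding eventually_nhds[where a = w] by blast
  qed
  moreover have "open (I - ?Z)"
  proof (subst open_subopen, rule ballI)
    fix w assume w: "w \<in> I - ?Z"
    obtain F where F: "(\<lambda>t. D (w + t)) has_fps_expansion F"
      using assms(3) w by (auto simp: analytic_near_def)
    have "(\<forall>\<^sub>F z in nhds w. P z) \<longleftrightarrow> (\<forall>\<^sub>F t in nhds 0. P (w + t))" for P
      using filtermap_nhds_shift[of "- w" 0] eventually_filtermap[of P "\<lambda>x. x - (- w)" "nhds 0"]
      by (simp add: add.commute)
    hence "\<not> (\<forall>\<^sub>F t in nhds 0. D (w + t) = 0)" using w by simp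
    hence "\<forall>\<^sub>F t in at 0. D (w + t) \<noteq> 0"
      using fps_expansion_eventually_zero_or_nonzero[OF F] by blast
    hence "\<forall>\<^sub>F z in at w. D z \<noteq> 0"
      by (subst at_to_0[of w]) (simp add: eventually_filtermap add.commute)
    then obtain S where S: "open S" "w \<in> S" "\<And>z. z \<in> S \<Longrightarrow> z \<noteq> w \<Longrightarrow> D z \<noteq> 0"
      by (auto simp: eventually_at_topological)
    have "S \<inter> I \<subseteq> I - ?Z"
    proof
      fix v assume v: "v \<in> S \<inter> I"
      show "v \<in> I - ?Z"
      proof (cases "v = w")
        case False
        thus ?thesis using v S eventually_nhds_x_imp_x[of "\<lambda>z. D z = 0" v] by auto
      qed (use w in auto)
    qed
    thus "\<exists>T. open T \<and> w \<in> T \<and> T \<subseteq> I - ?Z"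
      using S w assms(1) by (intro exI[of _ "S \<inter> I"]) auto
  qed
  ultimately have "?Z \<inter> I = {} \<or> (I - ?Z) \<inter> I = {}"
    using assms(2) by (intro connectedD[of I]) auto
  hence "z \<in> ?Z"
    using assms by blast
  thus ?thesis by (auto dest: eventually_nhds_x_imp_x)
qed

text \<open>Abel's theorem: with \<open>S n\<close> the partial sums, \<open>\<Sum>n. c n * t ^ n = (1 - t) * (\<Sum>n. S n * t ^ n)\<close>,
  so replacing \<open>S n\<close> by \<open>S n - L\<close> the difference to the limit is a weighted mean of null values.\<close>

lemma Abel_limit:
  fixes c :: "nat \<Rightarrow> real"
  assumes "c sums L"
  shows "((\<lambda>t. \<Sum>n. c n * t ^ n) \<longlongrightarrow> L) (at_left 1)"
proof -
  define d where "d n = (\<Sum>i\<le>n. c i) - L" for n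
  have d: "d \<longlonglongrightarrow> 0"
    using assms unfolding d_def sums_def_le by (simp add: LIM_zero)
  hence bd: "Bseq d" by (rule convergent_imp_Bseq[OF convergentI])
  then obtain K where K: "K > 0" "\<And>n. \<bar>d n\<bar> \<le> K" by (auto simp: Bseq_def)
  have sumd: "summable (\<lambda>n. \<bar>d n\<bar> * t ^ n)" if "0 \<le> t" "t < 1" for t
    by (rule summable_comparison_test'[where g = "\<lambda>n. K * t ^ n" and N = 0])
      (use that K in \<open>auto intro!: summable_mult summable_geometric mult_right_mono simp: abs_mult\<close>)
  have eq: "(\<Sum>n. c n * t ^ n) - L = (1 - t) * (\<Sum>n. d n * t ^ n)" if "0 \<le> t" "t < 1" for t
  proof -
    have sd: "summable (\<lambda>n. d n * t ^ n)"
      by (rule summable_norm_cancel) (use sumd[OF that] that in \<open>simp add: abs_mult\<close>)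
    have "(\<lambda>n. d (Suc n) * t ^ Suc n) sums ((\<Sum>n. d n * t ^ n) - d 0)"
      using summable_sums[OF sd] by (subst sums_Suc_iff) simp
    moreover have "(\<lambda>n. t * (d n * t ^ n)) sums (t * (\<Sum>n. d n * t ^ n))"
      using summable_sums[OF sd] by (rule sums_mult)
    ultimately have "(\<lambda>n. d (Suc n) * t ^ Suc n - t * (d n * t ^ n)) sums
        ((\<Sum>n. d n * t ^ n) - d 0 - t * (\<Sum>n. d n * t ^ n))"
      by (rule sums_diff)
    moreover have "d (Suc n) * t ^ Suc n - t * (d n * t ^ n) = c (Suc n) * t ^ Suc n" for n
      by (simp add: d_def algebra_simps)
    ultimately have "(\<lambda>n. c (Suc n) * t ^ Suc n) sums ((1 - t) * (\<Sum>n. d n * t ^ n) - d 0)"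
      by (simp add: algebra_simps)
    hence "(\<lambda>n. c n * t ^ n) sums ((1 - t) * (\<Sum>n. d n * t ^ n) - d 0 + c 0)"
      by (subst (asm) sums_Suc_iff) simp
    thus ?thesis by (simp add: sums_iff d_def)
  qed
  have bound: "\<bar>(\<Sum>n. c n * t ^ n) - L\<bar> \<le> (1 - t) * (K * N) + e"
    if t: "0 \<le> t" "t < 1" and e: "e > 0" "\<And>n. n \<ge> N \<Longrightarrow> \<bar>d n\<bar> \<le> e" for t e N
  proof -
    have geo: "summable (\<lambda>n. t ^ n)" "(\<Sum>n. t ^ n) = 1 / (1 - t)"
      using t by (auto intro!: summable_geometric suminf_geometric)
    have fin: "summable (\<lambda>n. if n < N then K else 0)" "(\<Sum>n. if n < N then K else 0) = K * N"
      using sums_If_finite_set[of "{..<N}" "\<lambda>_. K"] by (auto simp: sums_iff)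
    have "\<bar>\<Sum>n. d n * t ^ n\<bar> \<le> (\<Sum>n. \<bar>d n\<bar> * t ^ n)"
      using summable_rabs[of "\<lambda>n. d n * t ^ n"] sumd[OF t] t by (simp add: abs_mult)
    also have "\<dots> \<le> (\<Sum>n. (if n < N then K else 0) + e * t ^ n)"
    proof (rule suminf_le)
      fix n
      show "\<bar>d n\<bar> * t ^ n \<le> (if n < N then K else 0) + e * t ^ n"
      proof (cases "n < N")
        case True
        have "\<bar>d n\<bar> * t ^ n \<le> K * 1"
          using K t by (intro mult_mono) (auto intro!: power_le_one)
        moreover have "0 \<le> e * t ^ n" using e t by simp
        ultimately show ?thesis using True by simp
      qed (use e t in \<open>auto intro!: mult_right_mono\<close>)
    qed (use sumd[OF t] fin geo in \<open>auto intro!: summable_add summable_mult\<close>)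
    also have "\<dots> = K * N + e * (1 / (1 - t))"
      by (subst suminf_add[symmetric])
        (use fin geo in \<open>auto intro!: summable_mult simp: suminf_mult\<close>)
    finally have "(1 - t) * \<bar>\<Sum>n. d n * t ^ n\<bar> \<le> (1 - t) * (K * N + e * (1 / (1 - t)))"
      using t by (intro mult_left_mono) auto
    also have "\<dots> = (1 - t) * (K * N) + e"
      using t by (simp add: field_simps)
    finally show ?thesis
      using eq[OF t] t by (simp add: abs_mult)
  qed
  show ?thesis
  proof (rule tendstoI)
    fix e :: real assume "e > 0"
    then obtain N where N: "\<And>n. n \<ge> N \<Longrightarrow> \<bar>d n\<bar> \<le> e / 2"
      using LIMSEQ_D[OF d, of "e/2"] by (force simp: less_imp_le)
    have "((\<lambda>t. (1 - t) * (K * N) + e / 2) \<longlongrightarrow> (1 - 1) * (K * N) + e / 2) (at_left (1::real))"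
      by (intro tendsto_intros)
    hence "\<forall>\<^sub>F t in at_left 1. (1 - t) * (K * N) + e / 2 < e"
      by (rule order_tendstoD(2)) (use \<open>e > 0\<close> in auto)
    moreover have "\<forall>\<^sub>F t in at_left (1::real). t \<in> {0<..<1}"
      by (intro eventually_at_left_real) auto
    ultimately show "\<forall>\<^sub>F t in at_left 1. dist (\<Sum>n. c n * t ^ n) L < e"
    proof eventually_elim
      case (elim t)
      thus ?case using bound[of t "e/2" N] N \<open>e > 0\<close> by (auto simp: dist_real_def)
    qed
  qed
qed

section \<open>Inversion of \<open>H\<close> and \<open>G\<close>\<close>

lemma H_op_eq_coeff:
  assumes "(\<lambda>z. exp z * g z) has_fps_expansion F"
  shows "H_op g n = fact n * fps_nth F n"
  unfolding H_op_def using has_fps_expansion_higher_deriv[OF assms] .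

lemma H_op_has_fps_expansion:
  assumes "analytic_near g 0"
  shows "(\<lambda>z. exp z * g z) has_fps_expansion Abs_fps (\<lambda>n. H_op g n / fact n)"
proof -
  obtain F where F: "(\<lambda>z. exp z * g z) has_fps_expansion F"
    using analytic_near_exp_mult[OF assms] by (auto simp: analytic_near_def)
  moreover have "F = Abs_fps (\<lambda>n. H_op g n / fact n)"
    by (simp add: fps_eq_iff H_op_eq_coeff[OF F])
  ultimately show ?thesis by simp
qed

lemma sums_G_term_iff:
  "G_term f z sums s \<longleftrightarrow> (\<lambda>n. f n / fact n * z ^ n) sums (exp z * s)"
proof -
  have "G_term f z = (\<lambda>n. exp (- z) * (f n / fact n * z ^ n))"
    by (simp add: G_term_def fun_eq_iff)
  moreover have "exp (- z) * (exp z * s) = s" by (simp add: exp_minus)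
  ultimately show ?thesis
    using sums_mult_iff[of "exp (- z)" "\<lambda>n. f n / fact n * z ^ n" "exp z * s"]
    by (simp only: exp_not_eq_zero not_False_eq_True simp_thms)
qed

lemma summable_G_term_iff:
  "summable (G_term f z) \<longleftrightarrow> summable (\<lambda>n. f n / fact n * z ^ n)"
proof -
  have "s = exp z * (exp (- z) * s)" for s :: real by (simp add: exp_minus)
  thus ?thesis unfolding summable_def sums_G_term_iff by metis
qed

lemma G_op_H_op:
  assumes an: "\<And>w. analytic_near g w" and sm: "summable (G_term (H_op g) z)"
  shows "G_op (H_op g) z = g z"
proof -
  define c where "c n = H_op g n / fact n" for n
  define h where "h x = exp x * g x" for x
  have sc: "summable (\<lambda>n. c n * z ^ n)"
    using sm by (simp add: summable_G_term_iff c_def)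
  have hw: "analytic_near h w" for w
    unfolding h_def by (rule analytic_near_exp_mult[OF an])
  have near0: "\<forall>\<^sub>F x in nhds 0. (\<Sum>n. c n * x ^ n) = h x"
    using H_op_has_fps_expansion[OF an]
    by (simp add: has_fps_expansion_def eval_fps_def c_def h_def)
  have "(\<lambda>n. c n * z ^ n) sums h z"
  proof (cases "z = 0")
    case True
    have "(\<Sum>n. c n * 0 ^ n) = h 0"
      using near0 by (rule eventually_nhds_x_imp_x)
    thus ?thesis using True sc by (simp add: sums_iff)
  next
    case False
    define I where "I = {- \<bar>z\<bar><..<\<bar>z\<bar>}"
    have inside: "(\<Sum>n. c n * x ^ n) - h x = 0" if "x \<in> I" for x
    proof (rule analytic_near_identity[where I = I and a = 0 and D = "\<lambda>x. (\<Sum>n. c n * x ^ n) - h x"])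
      show "open I" "connected I" "0 \<in> I" "x \<in> I"
        using that False by (auto simp: I_def)
      show "analytic_near (\<lambda>x. (\<Sum>n. c n * x ^ n) - h x) w" if "w \<in> I" for w
        using that by (intro analytic_near_diff analytic_near_powser[OF sc] hw) (auto simp: I_def)
      show "\<forall>\<^sub>F x in nhds 0. (\<Sum>n. c n * x ^ n) - h x = 0"
        using near0 by eventually_elim simp
    qed
    have "((\<lambda>t. \<Sum>n. (c n * z ^ n) * t ^ n) \<longlongrightarrow> (\<Sum>n. c n * z ^ n)) (at_left 1)"
      by (rule Abel_limit[OF summable_sums[OF sc]])
    moreover have "\<forall>\<^sub>F t in at_left (1::real). t \<in> {0<..<1}"
      by (intro eventually_at_left_real) auto
    hence "\<forall>\<^sub>F t in at_left 1. (\<Sum>n. (c n * z ^ n) * t ^ n) = h (t * z)"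
    proof eventually_elim
      case (elim t)
      hence "\<bar>t * z\<bar> < \<bar>z\<bar>" using False by (simp add: abs_mult)
      hence "t * z \<in> I" by (auto simp: I_def abs_less_iff)
      thus ?case using inside[of "t * z"] by (simp add: power_mult_distrib mult_ac)
    qed
    ultimately have "((\<lambda>t. h (t * z)) \<longlongrightarrow> (\<Sum>n. c n * z ^ n)) (at_left 1)"
      by (rule Lim_transform_eventually)
    moreover have "((\<lambda>t. h (t * z)) \<longlongrightarrow> h (1 * z)) (at_left 1)"
      by (rule isCont_tendsto_compose[OF analytic_near_imp_isCont[OF hw]]) (intro tendsto_intros)
    ultimately have "(\<Sum>n. c n * z ^ n) = h z"
      using tendsto_unique[OF trivial_limit_at_left_real] by force
    thus ?thesis using sc by (simp add: sums_iff)
  qed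
  hence "G_term (H_op g) z sums g z"
    by (simp add: sums_G_term_iff c_def h_def)
  thus ?thesis by (simp add: G_op_def sums_iff)
qed

lemma real_entire_sums_G_term:
  assumes "real_entire g"
  shows "G_term (H_op g) z sums g z"
proof -
  obtain a where a: "\<And>z. (\<lambda>n. a n * z ^ n) sums g z"
    using assms by (auto simp: real_entire_def)
  define F where "F = Abs_fps a"
  have "conv_radius a = \<infinity>"
    using a by (intro conv_radius_inftyI'') (auto simp: sums_iff)
  hence F: "fps_conv_radius F = \<infinity>" by (simp add: F_def fps_conv_radius_def)
  have gF: "g = eval_fps F"
    using a by (auto simp: F_def eval_fps_def sums_iff fun_eq_iff)
  have conv: "fps_conv_radius (fps_exp 1 * F) = \<infinity>"
    using fps_conv_radius_mult[of "fps_exp 1" F] F by simp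
  have ev: "exp x * g x = eval_fps (fps_exp 1 * F) x" for x :: real
    using F by (simp add: gF eval_fps_mult)
  hence "(\<lambda>x. exp x * g x) has_fps_expansion fps_exp 1 * F"
    using conv by (simp add: has_fps_expansion_def)
  note H = H_op_eq_coeff[OF this]
  have "(\<lambda>n. fps_nth (fps_exp 1 * F) n * z ^ n) sums (exp z * g z)"
    using conv by (subst ev) (intro sums_eval_fps, simp)
  thus ?thesis by (simp add: sums_G_term_iff H)
qed

lemma H_op_G_op:
  assumes "\<And>z. summable (G_term f z)"
  shows "H_op (G_op f) n = f n"
proof -
  have "(\<lambda>n. f n / fact n * z ^ n) sums (exp z * G_op f z)" for z
    using summable_sums[OF assms[of z]] by (simp add: sums_G_term_iff G_op_def)
  hence "(\<lambda>z. exp z * G_op f z) has_fps_expansion Abs_fps (\<lambda>n. f n / fact n)"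
    by (rule has_fps_expansion_of_sums[OF zero_less_one])
  from H_op_eq_coeff[OF this] show ?thesis by simp
qed

section \<open>Power series in several variables\<close>

definition monomial_at :: "real ^ 'v::finite \<Rightarrow> ('v \<Rightarrow> nat) \<Rightarrow> real" where
  "monomial_at z k = (\<Prod>x\<in>UNIV. (z $ x) ^ k x)"

definition box_nhd :: "real \<Rightarrow> (real ^ 'v::finite) set" where
  "box_nhd r = {z. \<forall>x. \<bar>z $ x\<bar> < r}"

definition has_power_series :: "(real ^ 'v::finite \<Rightarrow> real) \<Rightarrow> (('v \<Rightarrow> nat) \<Rightarrow> real) \<Rightarrow> bool" where
  "has_power_series f a \<longleftrightarrow>
     (\<exists>r>0. \<forall>z\<in>box_nhd r. ((\<lambda>k. a k * monomial_at z k) has_sum f z) UNIV)"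

definition incr :: "'v \<Rightarrow> ('v \<Rightarrow> nat) \<Rightarrow> 'v \<Rightarrow> nat" where
  "incr x k = k(x := Suc (k x))"

lemma box_nhd_min: "box_nhd (min r s) = box_nhd r \<inter> box_nhd s"
  by (auto simp: box_nhd_def)

lemma zero_in_box_nhd: "r > 0 \<Longrightarrow> 0 \<in> box_nhd r"
  by (simp add: box_nhd_def)

lemma inj_incr: "inj (incr x)"
proof (rule injI)
  fix k l :: "'a \<Rightarrow> nat" assume *: "incr x k = incr x l"
  show "k = l"
  proof
    fix y show "k y = l y"
      using fun_cong[OF *, of y] by (cases "y = x") (simp_all add: incr_def)
  qed
qed

lemma range_incr: "range (incr x) = {k. k x \<noteq> 0}"
proof -
  have "k \<in> range (incr x)" if "k x \<noteq> 0" for k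
    using that by (intro image_eqI[of _ _ "k(x := k x - 1)"]) (auto simp: incr_def)
  moreover have "incr x k x \<noteq> 0" for k by (simp add: incr_def)
  ultimately show ?thesis by auto
qed

lemma monomial_at_split:
  "monomial_at z k = (z $ x) ^ k x * (\<Prod>y\<in>UNIV - {x}. (z $ y) ^ k y)"
  by (simp add: monomial_at_def prod.remove)

lemma monomial_at_incr: "monomial_at z (incr x k) = z $ x * monomial_at z k"
  by (simp add: monomial_at_split[of _ _ x] incr_def)

lemma monomial_at_add_axis:
  "monomial_at (z + t *\<^sub>R axis x 1) k =
     (z $ x + t) ^ k x * (\<Prod>y\<in>UNIV - {x}. (z $ y) ^ k y)"
  by (simp add: monomial_at_split[of _ _ x] axis_def)

lemma has_power_series_cong:
  fixes f g :: "real ^ 'v::finite \<Rightarrow> real"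
  assumes "has_power_series f a" "r > 0" "\<And>z. z \<in> box_nhd r \<Longrightarrow> f z = g z"
  shows "has_power_series g a"
proof -
  obtain s where s: "s > 0" "\<And>z. z \<in> box_nhd s \<Longrightarrow> ((\<lambda>k. a k * monomial_at z k) has_sum f z) UNIV"
    using assms(1) by (auto simp: has_power_series_def)
  show ?thesis
    unfolding has_power_series_def
  proof (intro exI conjI ballI)
    fix z :: "real ^ 'v" assume "z \<in> box_nhd (min r s)"
    hence "z \<in> box_nhd r" "z \<in> box_nhd s" by (auto simp: box_nhd_min)
    thus "((\<lambda>k. a k * monomial_at z k) has_sum g z) UNIV" using s(2)[of z] assms(3)[of z] by simp
  qed (use s assms in auto)
qed

lemma has_power_series_at_0:
  fixes f :: "real ^ 'v::finite \<Rightarrow> real"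
  assumes "has_power_series f a"
  shows "f 0 = a (\<lambda>_. 0)"
proof -
  have "((\<lambda>k. a k * monomial_at 0 k) has_sum f 0) UNIV"
    using assms by (auto simp: has_power_series_def zero_in_box_nhd)
  moreover have z: "monomial_at 0 k = 0" if k: "k \<noteq> (\<lambda>_. 0)" for k :: "'v \<Rightarrow> nat"
  proof -
    obtain x where "k x \<noteq> 0" using k by auto
    thus ?thesis by (auto simp: monomial_at_def intro!: prod_zero)
  qed
  ultimately have "((\<lambda>k. a k * monomial_at 0 k) has_sum f 0) {\<lambda>_. 0}"
    by (subst has_sum_cong_neutral[where T = UNIV]) auto
  moreover have "((\<lambda>k. a k * monomial_at 0 k) has_sum a (\<lambda>_. 0)) {\<lambda>_. 0}"
    by (rule has_sum_finiteI) (auto simp: monomial_at_def)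
  ultimately show ?thesis by (rule has_sum_unique)
qed

lemma real_analytic_vec_imp_power_series:
  fixes g :: "real ^ 'v::finite \<Rightarrow> real"
  assumes "real_analytic_vec g"
  obtains a where "has_power_series g a"
proof -
  obtain r a where r: "r > 0" and a: "\<And>z. dist z 0 < r \<Longrightarrow>
      ((\<lambda>k. a k * (\<Prod>x\<in>UNIV. (z $ x - 0 $ x) ^ k x)) has_sum g z) UNIV"
    using assms unfolding real_analytic_vec_def by blast
  let ?r = "r / real CARD('v)"
  have "((\<lambda>k. a k * monomial_at z k) has_sum g z) UNIV" if "z \<in> box_nhd ?r" for z
  proof -
    have "norm z \<le> (\<Sum>x\<in>UNIV. \<bar>z $ x\<bar>)" by (rule norm_le_l1_cart)
    also have "\<dots> < (\<Sum>x\<in>(UNIV :: 'v set). ?r)"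
      using that by (intro sum_strict_mono) (auto simp: box_nhd_def)
    also have "\<dots> = r" by simp
    finally show ?thesis using a[of z] by (simp add: monomial_at_def)
  qed
  hence "has_power_series g a"
    using r unfolding has_power_series_def by (intro exI[of _ ?r]) auto
  thus ?thesis by (rule that)
qed

lemma has_power_series_0: "has_power_series (\<lambda>_. 0) (\<lambda>_. 0)"
  by (auto simp: has_power_series_def intro!: exI[of _ 1])

lemma has_power_series_add:
  fixes f g :: "real ^ 'v::finite \<Rightarrow> real"
  assumes "has_power_series f a" "has_power_series g b"
  shows "has_power_series (\<lambda>z. f z + g z) (\<lambda>k. a k + b k)"
proof -
  obtain r where r: "r > 0" "\<And>z. z \<in> box_nhd r \<Longrightarrow> ((\<lambda>k. a k * monomial_at z k) has_sum f z) UNIV"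
    using assms(1) by (auto simp: has_power_series_def)
  obtain s where s: "s > 0" "\<And>z. z \<in> box_nhd s \<Longrightarrow> ((\<lambda>k. b k * monomial_at z k) has_sum g z) UNIV"
    using assms(2) by (auto simp: has_power_series_def)
  show ?thesis
    unfolding has_power_series_def
  proof (intro exI[of _ "min r s"] conjI ballI)
    fix z :: "real ^ 'v" assume "z \<in> box_nhd (min r s)"
    hence "z \<in> box_nhd r" "z \<in> box_nhd s" by (auto simp: box_nhd_min)
    thus "((\<lambda>k. (a k + b k) * monomial_at z k) has_sum (f z + g z)) UNIV"
      using has_sum_add[OF r(2) s(2), of z z] by (simp add: algebra_simps)
  qed (use r s in auto)
qed

lemma has_power_series_cmult:
  assumes "has_power_series f a"
  shows "has_power_series (\<lambda>z. c * f z) (\<lambda>k. c * a k)"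
proof -
  obtain r where r: "r > 0" "\<And>z. z \<in> box_nhd r \<Longrightarrow> ((\<lambda>k. a k * monomial_at z k) has_sum f z) UNIV"
    using assms(1) by (auto simp: has_power_series_def)
  show ?thesis
    unfolding has_power_series_def
    using r(1) has_sum_cmult_right[OF r(2), of _ c] by (auto intro!: exI[of _ r] simp: mult.assoc)
qed

lemma has_power_series_diff:
  assumes "has_power_series f a" "has_power_series g b"
  shows "has_power_series (\<lambda>z. f z - g z) (\<lambda>k. a k - b k)"
  using has_power_series_add[OF assms(1) has_power_series_cmult[OF assms(2), of "-1"]] by simp

lemma has_power_series_sum:
  assumes "finite S" "\<And>i. i \<in> S \<Longrightarrow> has_power_series (f i) (a i)"
  shows "has_power_series (\<lambda>z. \<Sum>i\<in>S. f i z) (\<lambda>k. \<Sum>i\<in>S. a i k)"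
  using assms
  by (induction S) (auto intro: has_power_series_0 has_power_series_add)

lemma has_power_series_coord_mult:
  assumes "has_power_series f a"
  shows "has_power_series (\<lambda>z. z $ x * f z) (\<lambda>k. if k x = 0 then 0 else a (k(x := k x - 1)))"
    (is "has_power_series _ ?b")
proof -
  obtain r where r: "r > 0" "\<And>z. z \<in> box_nhd r \<Longrightarrow> ((\<lambda>k. a k * monomial_at z k) has_sum f z) UNIV"
    using assms(1) by (auto simp: has_power_series_def)
  have b: "?b (incr x k) = a k" for k by (simp add: incr_def)
  have "((\<lambda>k. ?b k * monomial_at z k) has_sum (z $ x * f z)) UNIV" if "z \<in> box_nhd r" for z
  proof -
    have "((\<lambda>k. ?b (incr x k) * monomial_at z (incr x k)) has_sum (z $ x * f z)) UNIV"
      using has_sum_cmult_right[OF r(2)[OF that], of "z $ x"]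
      unfolding b monomial_at_incr by (simp add: mult_ac)
    hence "((\<lambda>k. ?b k * monomial_at z k) has_sum (z $ x * f z)) (range (incr x))"
      by (subst has_sum_reindex[OF inj_incr]) (simp add: o_def)
    thus ?thesis
      by (subst has_sum_cong_neutral[where T = "range (incr x)"]) (auto simp: range_incr)
  qed
  thus ?thesis using r(1) by (auto simp: has_power_series_def)
qed

text \<open>The Cauchy product: for fixed \<open>n\<close> only finitely many pairs \<open>(j, l)\<close> satisfy \<open>j + l = n\<close>.\<close>

lemma has_power_series_mult:
  fixes f g :: "real ^ 'v::finite \<Rightarrow> real"
  assumes "has_power_series f a" "has_power_series g b"
  obtains c where "has_power_series (\<lambda>z. f z * g z) c"
proof -
  obtain r where r: "r > 0" "\<And>z. z \<in> box_nhd r \<Longrightarrow> ((\<lambda>k. a k * monomial_at z k) has_sum f z) UNIV"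
    using assms(1) by (auto simp: has_power_series_def)
  obtain s where s: "s > 0" "\<And>z. z \<in> box_nhd s \<Longrightarrow> ((\<lambda>k. b k * monomial_at z k) has_sum g z) UNIV"
    using assms(2) by (auto simp: has_power_series_def)
  define A where "A n = {(j, l). (\<lambda>x. j x + l x) = n}" for n :: "'v \<Rightarrow> nat"
  define c where "c n = (\<Sum>(j, l)\<in>A n. a j * b l)" for n
  have finA: "finite (A n)" for n
  proof (rule finite_subset)
    have "finite (\<Pi>\<^sub>E x\<in>UNIV. {..n x})" by (intro finite_PiE) auto
    thus "finite ((\<Pi>\<^sub>E x\<in>UNIV. {..n x}) \<times> (\<Pi>\<^sub>E x\<in>UNIV. {..n x}))" by blast
    show "A n \<subseteq> (\<Pi>\<^sub>E x\<in>UNIV. {..n x}) \<times> (\<Pi>\<^sub>E x\<in>UNIV. {..n x})" by (auto simp: A_def)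
  qed
  have "((\<lambda>n. c n * monomial_at z n) has_sum (f z * g z)) UNIV"
    if z: "z \<in> box_nhd (min r s)" for z :: "real ^ 'v"
  proof -
    define u where "u k = a k * monomial_at z k" for k
    define v where "v k = b k * monomial_at z k" for k
    have u: "(u has_sum f z) UNIV" and v: "(v has_sum g z) UNIV"
      using z r(2)[of z] s(2)[of z] by (simp_all add: u_def[abs_def] v_def[abs_def] box_nhd_min)
    have "(\<lambda>(j, l). u j * v l) summable_on UNIV \<times> UNIV"
    proof (rule Infinite_Sum.abs_summable_summable, subst Infinite_Sum.abs_summable_on_Sigma_iff, intro conjI ballI)
      have au: "(\<lambda>j. \<bar>u j\<bar>) summable_on UNIV" and av: "(\<lambda>l. \<bar>v l\<bar>) summable_on UNIV"
        using has_sum_imp_summable[OF u] has_sum_imp_summable[OF v]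
          summable_on_iff_abs_summable_on_real[of u UNIV] summable_on_iff_abs_summable_on_real[of v UNIV]
        by (simp_all only: real_norm_def)
      show "(\<lambda>l. norm (case (j, l) of (j, l) \<Rightarrow> u j * v l)) summable_on UNIV" for j
        using summable_on_cmult_right[OF av, of "\<bar>u j\<bar>"] by (simp add: abs_mult)
      show "(\<lambda>j. norm (\<Sum>\<^sub>\<infinity>l. norm (case (j, l) of (j, l) \<Rightarrow> u j * v l))) summable_on UNIV"
        using summable_on_cmult_left[OF au, of "\<Sum>\<^sub>\<infinity>l. \<bar>v l\<bar>"]
        by (simp add: abs_mult infsum_cmult_right' infsum_nonneg)
    qed
    hence prod: "((\<lambda>(j, l). u j * v l) has_sum (f z * g z)) (UNIV \<times> UNIV)"
    proof (intro has_sum_SigmaI[where g = "\<lambda>j. u j * g z"])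
      show "((\<lambda>l. case (j, l) of (j, l) \<Rightarrow> u j * v l) has_sum u j * g z) UNIV" for j
        using has_sum_cmult_right[OF v] by simp
      show "((\<lambda>j. u j * g z) has_sum f z * g z) UNIV"
        using has_sum_cmult_left[OF u] .
    qed
    have "bij_betw snd (Sigma UNIV A) (UNIV \<times> UNIV)"
      by (rule bij_betwI[where g = "\<lambda>(j, l). ((\<lambda>x. j x + l x), (j, l))"]) (auto simp: A_def)
    from has_sum_reindex_bij_betw[OF this, of "\<lambda>(j, l). u j * v l"] prod
    have "((\<lambda>p. case snd p of (j, l) \<Rightarrow> u j * v l) has_sum (f z * g z)) (Sigma UNIV A)"
      by simp
    hence "((\<lambda>n. \<Sum>(j, l)\<in>A n. u j * v l) has_sum (f z * g z)) UNIV"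
      by (rule has_sum_SigmaD) (auto intro: has_sum_finite finA)
    moreover have "(\<Sum>(j, l)\<in>A n. u j * v l) = c n * monomial_at z n" for n
      unfolding c_def sum_distrib_right
    proof (rule sum.cong)
      fix p assume "p \<in> A n"
      then obtain j l where p: "p = (j, l)" and n: "n = (\<lambda>x. j x + l x)" by (auto simp: A_def)
      have "monomial_at z n = monomial_at z j * monomial_at z l"
        by (simp add: n monomial_at_def power_add prod.distrib)
      thus "(case p of (j, l) \<Rightarrow> u j * v l) = (case p of (j, l) \<Rightarrow> a j * b l) * monomial_at z n"
        by (simp add: p u_def v_def)
    qed simp
    ultimately show ?thesis by simp
  qed
  hence "has_power_series (\<lambda>z. f z * g z) c"
    using r(1) s(1) unfolding has_power_series_def by (intro exI[of _ "min r s"]) auto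
  thus ?thesis by (rule that)
qed

lemma has_power_series_exp_coord:
  "has_power_series (\<lambda>z :: real ^ 'v::finite. exp (z $ x)) (\<lambda>k. if \<forall>y. y \<noteq> x \<longrightarrow> k y = 0 then 1 / fact (k x) else 0)"
    (is "has_power_series _ ?a")
  unfolding has_power_series_def
proof (intro exI[of _ 1] conjI ballI)
  fix z :: "real ^ 'v"
  define h where "h m = (\<lambda>_::'v. 0::nat)(x := m)" for m
  have "inj h"
    by (rule injI) (metis fun_upd_same h_def)
  have "(\<lambda>m. (z $ x) ^ m /\<^sub>R fact m) sums exp (z $ x)"
    by (rule exp_converges)
  hence "((\<lambda>m. (z $ x) ^ m /\<^sub>R fact m) has_sum exp (z $ x)) UNIV"
    by (rule norm_summable_imp_has_sum[OF summable_norm_exp])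
  moreover have "?a (h m) * monomial_at z (h m) = (z $ x) ^ m /\<^sub>R fact m" for m
    by (simp add: monomial_at_split[of _ _ x] h_def divide_inverse)
  ultimately have "((\<lambda>k. ?a k * monomial_at z k) has_sum exp (z $ x)) (range h)"
    by (subst has_sum_reindex[OF \<open>inj h\<close>]) (simp add: o_def)
  moreover have "k \<in> range h" if "\<forall>y. y \<noteq> x \<longrightarrow> k y = 0" for k
    using that by (intro image_eqI[of _ _ "k x"]) (auto simp: h_def)
  ultimately show "((\<lambda>k. ?a k * monomial_at z k) has_sum exp (z $ x)) UNIV"
    by (subst has_sum_cong_neutral[where T = "range h"]) auto
qed simp

lemma has_power_series_exp_sum:
  fixes S :: "'v::finite set"
  obtains c where "has_power_series (\<lambda>z. exp (\<Sum>x\<in>S. z $ x)) c"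
proof -
  have "\<exists>c. has_power_series (\<lambda>z. exp (\<Sum>x\<in>S. z $ x)) c"
    using finite[of S]
  proof (induction S)
    case empty
    have "((\<lambda>k. (if k = (\<lambda>_. 0) then 1 else 0) * monomial_at z k) has_sum 1) UNIV" for z :: "real ^ 'v"
    proof (subst has_sum_cong_neutral[where T = "{\<lambda>_. 0}"])
      show "((\<lambda>k. (if k = (\<lambda>_. 0) then 1 else 0) * monomial_at z k) has_sum 1) {\<lambda>_. 0}"
        by (rule has_sum_finiteI) (auto simp: monomial_at_def)
    qed auto
    hence "has_power_series (\<lambda>z :: real ^ 'v. 1) (\<lambda>k. if k = (\<lambda>_. 0) then 1 else 0)"
      by (auto simp: has_power_series_def intro!: exI[of _ 1])
    thus ?case by auto
  next
    case (insert x S)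
    then obtain c where "has_power_series (\<lambda>z. exp (\<Sum>x\<in>S. z $ x)) c" by blast
    from has_power_series_mult[OF has_power_series_exp_coord[of x] this] insert.hyps
    show ?case by (auto simp: exp_add)
  qed
  thus ?thesis using that by blast
qed

section \<open>Partial derivatives of power series\<close>

lemma times_power_le_power:
  fixes q \<rho> :: real
  assumes "0 \<le> q" "q < \<rho>"
  obtains C where "C \<ge> 0" "\<And>m. real m * q ^ (m - 1) \<le> C * \<rho> ^ m"
proof -
  have \<rho>: "\<rho> > 0" using assms by simp
  have "(\<lambda>n. real n * (q / \<rho>) ^ n) \<longlonglongrightarrow> 0"
    using powser_times_n_limit_0[of "q / \<rho>"] assms by simp
  hence "Bseq (\<lambda>n. real n * (q / \<rho>) ^ n)"
    by (intro convergent_imp_Bseq convergentI)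
  then obtain K where K: "K > 0" "\<And>n. norm (real n * (q / \<rho>) ^ n) \<le> K"
    unfolding Bseq_def by blast
  show ?thesis
  proof (rule that[of "(K + 1) / \<rho>"])
    fix m
    show "real m * q ^ (m - 1) \<le> (K + 1) / \<rho> * \<rho> ^ m"
    proof (cases m)
      case (Suc n)
      have "real n * (q / \<rho>) ^ n \<le> K"
        using K(2)[of n] by simp
      moreover have "(q / \<rho>) ^ n \<le> 1"
        using assms by (intro power_le_one) auto
      ultimately have "real (Suc n) * (q / \<rho>) ^ n \<le> K + 1"
        by (simp add: algebra_simps)
      hence "real (Suc n) * (q / \<rho>) ^ n * \<rho> ^ n \<le> (K + 1) * \<rho> ^ n"
        using \<rho> by (intro mult_right_mono) auto
      thus ?thesis using \<rho> Suc by (simp add: power_divide)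
    qed (use K \<rho> in simp)
  qed (use K \<rho> in simp)
qed

text \<open>Termwise differentiation along the \<open>x\<close>-axis: the differentiated terms are dominated by the
  terms of the series at a point of larger \<open>x\<close>-coordinate \<open>\<rho>\<close>.\<close>

lemma power_series_partial_at:
  fixes f :: "real ^ 'v::finite \<Rightarrow> real"
  assumes ser: "\<And>z. z \<in> box_nhd r \<Longrightarrow> ((\<lambda>k. a k * monomial_at z k) has_sum f z) UNIV"
    and z: "z \<in> box_nhd r"
  shows "((\<lambda>t. f (z + t *\<^sub>R axis x 1)) has_field_derivative partial x f z) (at 0)"
    and "((\<lambda>k. real (Suc (k x)) * a (incr x k) * monomial_at z k) has_sum partial x f z) UNIV"
proof -
  define u where "u = z $ x"
  have "\<bar>u\<bar> < r" using z by (simp add: u_def box_nhd_def)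
  then obtain \<rho> where \<rho>: "\<bar>u\<bar> < \<rho>" "\<rho> < r" using dense by blast
  obtain q where q: "\<bar>u\<bar> < q" "q < \<rho>" using \<rho>(1) dense by blast
  obtain C where C: "C \<ge> 0" "\<And>m. real m * q ^ (m - 1) \<le> C * \<rho> ^ m"
    using times_power_le_power[of q \<rho>] q by (metis abs_ge_zero less_imp_le order_trans)
  define P where "P k = (\<Prod>y\<in>UNIV - {x}. (z $ y) ^ k y)" for k
  have line: "z + t *\<^sub>R axis x 1 \<in> box_nhd r" if "\<bar>u + t\<bar> < r" for t
    using that z by (auto simp: box_nhd_def u_def axis_def)
  have ser': "((\<lambda>k. a k * P k * s ^ k x) has_sum f (z + (s - u) *\<^sub>R axis x 1)) UNIV"
    if "\<bar>s\<bar> < r" for s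
    using ser[OF line[of "s - u"]] that by (simp add: monomial_at_add_axis P_def u_def mult_ac)
  define M where "M k = C * \<bar>a k * P k * \<rho> ^ k x\<bar>" for k
  have "(\<lambda>k. a k * P k * \<rho> ^ k x) summable_on UNIV"
    using ser'[of \<rho>] \<rho> by (auto simp: summable_on_def)
  hence M: "M summable_on UNIV"
    unfolding M_def
    by (intro summable_on_cmult_right) (subst (asm) summable_on_iff_abs_summable_on_real, simp)
  have dom: "\<bar>a k * P k * (real (k x) * s ^ (k x - 1))\<bar> \<le> M k" if "\<bar>s\<bar> \<le> q" for s k
  proof -
    have "real (k x) * \<bar>s\<bar> ^ (k x - 1) \<le> real (k x) * q ^ (k x - 1)"
      using that by (intro mult_left_mono power_mono) auto
    also have "\<dots> \<le> C * \<rho> ^ k x" by (rule C)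
    finally have "\<bar>a k * P k\<bar> * (real (k x) * \<bar>s\<bar> ^ (k x - 1)) \<le> \<bar>a k * P k\<bar> * (C * \<rho> ^ k x)"
      by (intro mult_left_mono) auto
    thus ?thesis using \<rho> by (simp add: M_def abs_mult power_abs mult_ac)
  qed
  define e where "e = from_nat_into (UNIV :: ('v \<Rightarrow> nat) set)"
  have "infinite (UNIV :: ('v \<Rightarrow> nat) set)"
    using finite_fun_UNIVD2 infinite_UNIV_nat by blast
  hence e: "bij e"
    unfolding e_def by (intro bij_betw_from_nat_into) auto
  have Me: "summable (\<lambda>i. M (e i))"
    using M by (intro summable_on_imp_summable) (simp add: summable_on_reindex_bij_betw[OF e])
  have deriv: "((\<lambda>s. \<Sum>i. a (e i) * P (e i) * s ^ e i x) has_field_derivative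
      (\<Sum>i. a (e i) * P (e i) * (real (e i x) * u ^ (e i x - 1)))) (at u)"
  proof (rule has_field_derivative_series'(2)[where S = "{-q..q}" and x0 = u
        and f' = "\<lambda>i s. a (e i) * P (e i) * (real (e i x) * s ^ (e i x - 1))"])
    show "((\<lambda>s. a (e i) * P (e i) * s ^ e i x) has_field_derivative
        a (e i) * P (e i) * (real (e i x) * s ^ (e i x - 1))) (at s within {-q..q})" for i s
      by (auto intro!: derivative_eq_intros)
    show "uniformly_convergent_on {-q..q}
        (\<lambda>n s. \<Sum>i<n. a (e i) * P (e i) * (real (e i x) * s ^ (e i x - 1)))"
      using Me by (rule Weierstrass_m_test'[rotated]) (use dom in auto)
    show "summable (\<lambda>i. a (e i) * P (e i) * u ^ e i x)"
      using ser'[OF \<open>\<bar>u\<bar> < r\<close>]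
      by (intro summable_on_imp_summable)
        (auto simp: summable_on_def has_sum_reindex_bij_betw[OF e, of "\<lambda>k. a k * P k * u ^ k x"])
    show "u \<in> interior {-q..q}" "u \<in> {-q..q}"
      using q by (auto simp: abs_less_iff)
  qed auto
  define D where "D = (\<Sum>i. a (e i) * P (e i) * (real (e i x) * u ^ (e i x - 1)))"
  have feq: "(\<Sum>i. a (e i) * P (e i) * s ^ e i x) = f (z + (s - u) *\<^sub>R axis x 1)"
    if "\<bar>s\<bar> < r" for s
  proof -
    have "((\<lambda>i. a (e i) * P (e i) * s ^ e i x) has_sum f (z + (s - u) *\<^sub>R axis x 1)) UNIV"
      using ser'[OF that] has_sum_reindex_bij_betw[OF e, of "\<lambda>k. a k * P k * s ^ k x"] by blast
    thus ?thesis by (rule sums_unique[OF has_sum_imp_sums, symmetric])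
  qed
  have "\<forall>\<^sub>F s in nhds u. s \<in> ball 0 r"
    using \<open>\<bar>u\<bar> < r\<close> by (intro eventually_nhds_in_open) auto
  hence "\<forall>\<^sub>F s in nhds u. (\<Sum>i. a (e i) * P (e i) * s ^ e i x) = f (z + (s - u) *\<^sub>R axis x 1)"
    by eventually_elim (simp add: feq)
  with deriv have "((\<lambda>s. f (z + (s - u) *\<^sub>R axis x 1)) has_field_derivative D) (at (0 + u))"
    unfolding D_def by (simp add: DERIV_cong_ev[OF refl _ refl])
  hence D: "((\<lambda>t. f (z + t *\<^sub>R axis x 1)) has_field_derivative D) (at 0)"
    using DERIV_shift[of "\<lambda>s. f (z + (s - u) *\<^sub>R axis x 1)" D 0 u] by simp
  hence partial: "partial x f z = D"
    unfolding partial_def by (rule DERIV_imp_deriv)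
  show "((\<lambda>t. f (z + t *\<^sub>R axis x 1)) has_field_derivative partial x f z) (at 0)"
    using D partial by simp
  show "((\<lambda>k. real (Suc (k x)) * a (incr x k) * monomial_at z k) has_sum partial x f z) UNIV"
  proof -
    let ?d = "\<lambda>k. a k * P k * (real (k x) * u ^ (k x - 1))"
    have "summable (\<lambda>i. norm (?d (e i)))"
      using Me by (rule summable_comparison_test'[where N = 0]) (use dom q in auto)
    moreover from this have "(\<lambda>i. ?d (e i)) sums D"
      unfolding D_def by (rule summable_sums[OF summable_norm_cancel])
    ultimately have "((\<lambda>i. ?d (e i)) has_sum D) UNIV"
      by (rule norm_summable_imp_has_sum)
    hence "(?d has_sum D) UNIV"
      using has_sum_reindex_bij_betw[OF e, of ?d] by simp
    hence "(?d has_sum D) (range (incr x))"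
      by (subst has_sum_cong_neutral[where T = UNIV]) (auto simp: range_incr)
    hence "((\<lambda>k. ?d (incr x k)) has_sum D) UNIV"
      by (subst (asm) has_sum_reindex[OF inj_incr]) (simp add: o_def)
    moreover have "?d (incr x k) = real (Suc (k x)) * a (incr x k) * monomial_at z k" for k
      by (simp add: incr_def P_def u_def monomial_at_split[of _ _ x])
    ultimately show ?thesis by (simp only: partial)
  qed
qed

lemma has_power_series_partial:
  assumes "has_power_series f a"
  shows "has_power_series (partial x f) (\<lambda>k. real (Suc (k x)) * a (incr x k))"
proof -
  obtain r where r: "r > 0" "\<And>z. z \<in> box_nhd r \<Longrightarrow> ((\<lambda>k. a k * monomial_at z k) has_sum f z) UNIV"
    using assms(1) by (auto simp: has_power_series_def)
  show ?thesis
    unfolding has_power_series_def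
    by (intro exI[of _ r] conjI ballI r(1) power_series_partial_at(2)[OF r(2)])
qed

lemma has_power_series_differentiable:
  assumes "has_power_series f a"
  obtains r where "r > 0" "\<And>z x. z \<in> box_nhd r \<Longrightarrow>
    ((\<lambda>t. f (z + t *\<^sub>R axis x 1)) has_field_derivative partial x f z) (at 0)"
proof -
  obtain r where r: "r > 0" "\<And>z. z \<in> box_nhd r \<Longrightarrow> ((\<lambda>k. a k * monomial_at z k) has_sum f z) UNIV"
    using assms(1) by (auto simp: has_power_series_def)
  show ?thesis
    by (rule that[OF r(1)]) (rule power_series_partial_at(1)[OF r(2)])
qed

lemma has_power_series_partial_funpow:
  assumes "has_power_series f a"
  shows "has_power_series ((partial x ^^ m) f)
    (\<lambda>k. fact (k x + m) / fact (k x) * a (k(x := k x + m)))"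
proof (induction m)
  case 0
  then show ?case using assms by simp
next
  case (Suc m)
  have eq: "(\<lambda>k. real (Suc (k x)) * (fact (incr x k x + m) / fact (incr x k x) *
      a ((incr x k)(x := incr x k x + m)))) =
    (\<lambda>k. fact (k x + Suc m) / fact (k x) * a (k(x := k x + Suc m)))"
    by (rule ext) (simp add: incr_def field_simps del: of_nat_Suc)
  from has_power_series_partial[OF Suc.IH, of x] show ?case
    unfolding eq by (simp only: funpow.simps o_apply)
qed

lemma has_power_series_foldr_partial:
  assumes "has_power_series f a" "distinct xs"
  shows "has_power_series (foldr (\<lambda>x. partial x ^^ n x) xs f)
    (\<lambda>k. (\<Prod>x\<in>set xs. fact (k x + n x) / fact (k x)) *
      a (\<lambda>x. if x \<in> set xs then k x + n x else k x))"
  using assms(2)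
proof (induction xs)
  case Nil
  then show ?case using assms by simp
next
  case (Cons x xs)
  let ?k = "\<lambda>k. k(x := k x + n x)"
  have "(\<Prod>y\<in>set xs. fact (?k k y + n y) / fact (?k k y)) =
      (\<Prod>y\<in>set xs. fact (k y + n y) / fact (k y) :: real)" for k
    using Cons.prems by (intro prod.cong) auto
  moreover have "(\<lambda>y. if y \<in> set xs then ?k k y + n y else ?k k y) =
      (\<lambda>y. if y \<in> set (x # xs) then k y + n y else k y)" for k
    using Cons.prems by auto
  ultimately have eq: "(\<lambda>k. fact (k x + n x) / fact (k x) *
      ((\<Prod>y\<in>set xs. fact (?k k y + n y) / fact (?k k y)) *
        a (\<lambda>y. if y \<in> set xs then ?k k y + n y else ?k k y))) =
      (\<lambda>k. (\<Prod>y\<in>set (x # xs). fact (k y + n y) / fact (k y)) *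
        a (\<lambda>y. if y \<in> set (x # xs) then k y + n y else k y))"
    using Cons.prems by (intro ext) (simp only: list.set prod.insert[OF finite_set] distinct.simps mult.assoc simp_thms)
  have "distinct xs" using Cons.prems by simp
  from has_power_series_partial_funpow[OF Cons.IH[OF this], where x = x and m = "n x"] show ?case
    unfolding eq by (simp only: foldr.simps o_apply)
qed

lemma partials_at_0:
  assumes "has_power_series f a"
  shows "partials n f 0 = (\<Prod>x\<in>UNIV. fact (n x)) * a n"
proof -
  have "\<exists>xs :: 'a list. distinct xs \<and> set xs = UNIV"
    using finite_distinct_list[OF finite] by blast
  hence e: "distinct (enumeration :: 'a list)" "set (enumeration :: 'a list) = UNIV"
    unfolding enumeration_def by (metis (mono_tags, lifting) someI_ex)+
  from has_power_series_at_0[OF has_power_series_foldr_partial[OF assms e(1), of n]]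
  show ?thesis by (simp add: partials_def e(2))
qed

section \<open>The intertwining relation\<close>

definition exp_sum :: "real ^ 'v::finite \<Rightarrow> real" where
  "exp_sum z = exp (\<Sum>x\<in>UNIV. z $ x)"

lemma partial_exp_sum_mult:
  assumes "((\<lambda>t. g (z + t *\<^sub>R axis x 1)) has_field_derivative partial x g z) (at 0)"
  shows "partial x (\<lambda>z. exp_sum z * g z) z = exp_sum z * g z + exp_sum z * partial x g z"
proof -
  have "exp_sum (z + t *\<^sub>R axis x 1) = exp_sum z * exp t" for t
    by (simp add: exp_sum_def sum.distrib axis_def if_distrib[of "(*) _"] exp_add cong: if_cong)
  hence "((\<lambda>t. exp_sum (z + t *\<^sub>R axis x 1) * g (z + t *\<^sub>R axis x 1)) has_field_derivative
      exp_sum z * g z + exp_sum z * partial x g z) (at 0)"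
    using assms by (auto intro!: derivative_eq_intros)
  thus ?thesis unfolding partial_def by (rule DERIV_imp_deriv)
qed

text \<open>\<open>\<partial>\<^sub>x - \<partial>\<^sub>y\<close> annihilates \<open>exp_sum\<close>, hence commutes with multiplication by it.\<close>

lemma has_power_series_exp_sum_partial_diff:
  assumes g: "has_power_series g a" and b: "has_power_series (\<lambda>z. exp_sum z * g z) b"
  shows "has_power_series (\<lambda>z. exp_sum z * partial_diff x y g z)
    (\<lambda>k. real (Suc (k x)) * b (incr x k) - real (Suc (k y)) * b (incr y k))"
proof -
  obtain r where r: "r > 0" "\<And>z x. z \<in> box_nhd r \<Longrightarrow>
      ((\<lambda>t. g (z + t *\<^sub>R axis x 1)) has_field_derivative partial x g z) (at 0)"
    using has_power_series_differentiable[OF g] by metis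
  show ?thesis
  proof (rule has_power_series_cong[OF
        has_power_series_diff[OF has_power_series_partial[OF b, of x] has_power_series_partial[OF b, of y]] r(1)])
    fix z :: "real ^ 'a" assume "z \<in> box_nhd r"
    thus "partial x (\<lambda>z. exp_sum z * g z) z - partial y (\<lambda>z. exp_sum z * g z) z =
        exp_sum z * partial_diff x y g z"
      by (simp add: partial_exp_sum_mult[OF r(2)] partial_diff_def algebra_simps)
  qed
qed

lemma has_power_series_partial_diff:
  assumes "has_power_series g a"
  obtains a' where "has_power_series (partial_diff x y g) a'"
  using has_power_series_diff[OF has_power_series_partial[OF assms, of x] has_power_series_partial[OF assms, of y]]
  by (rule that[unfolded partial_diff_def[abs_def]])

text \<open>In terms of the coefficients \<open>b\<close> of \<open>exp_sum z * g z\<close>, multiplication by \<open>z $ x\<close> and \<open>\<partial>\<^sub>x\<close>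
  become index shifts, which act on \<open>h n = n! * b n\<close> as annihilation and creation of a particle.\<close>

lemma L_pair_factorial_coeff:
  fixes b :: "('v::finite \<Rightarrow> nat) \<Rightarrow> real"
  defines "h \<equiv> \<lambda>n. (\<Prod>x\<in>UNIV. fact (n x)) * b n"
  defines "shift \<equiv> \<lambda>x (a :: ('v \<Rightarrow> nat) \<Rightarrow> real) k. if k x = 0 then 0 else a (k(x := k x - 1))"
  defines "d \<equiv> \<lambda>x y (a :: ('v \<Rightarrow> nat) \<Rightarrow> real) k.
    real (Suc (k x)) * a (incr x k) - real (Suc (k y)) * a (incr y k)"
  assumes "x \<noteq> y"
  shows "L_pair \<sigma> \<beta> x y h n =
    (\<Prod>x\<in>UNIV. fact (n x)) *
      (- \<beta> * (shift x (d x y b) n - shift y (d x y b) n) +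
       \<sigma> * shift x (shift y (d x y (d x y b))) n)"
proof -
  define R where "R = (\<Prod>v\<in>UNIV - {x} - {y}. fact (n v) :: real)"
  define B where "B i j = b (n(x := i, y := j))" for i j
  have ne: "y \<noteq> x" using \<open>x \<noteq> y\<close> by blast
  have tw: "n(y := j, x := i) = n(x := i, y := j)" for i j
    using ne by (simp add: fun_upd_twist)
  have fac: "(\<Prod>v\<in>UNIV. fact ((n(x := i, y := j)) v)) = R * fact i * (fact j :: real)" for i j
  proof -
    have "(\<Prod>v\<in>UNIV - {x} - {y}. fact ((n(x := i, y := j)) v)) = R"
      unfolding R_def by (intro prod.cong) auto
    thus ?thesis
      using ne by (simp add: prod.remove[of UNIV x] prod.remove[of "UNIV - {x}" y] del: fun_upd_apply)
        (simp add: mult_ac)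
  qed
  have h: "h (n(x := i, y := j)) = R * fact i * fact j * B i j" for i j
    by (simp only: h_def fac B_def)
  have d1: "d x y b (n(x := i, y := j)) = real (Suc i) * B (Suc i) j - real (Suc j) * B i (Suc j)" for i j
    using ne by (simp add: d_def incr_def B_def tw)
  have d2: "d x y (d x y b) (n(x := i, y := j)) =
      real (Suc i) * d x y b (n(x := Suc i, y := j)) - real (Suc j) * d x y b (n(x := i, y := Suc j))" for i j
    using ne by (subst d_def) (simp add: incr_def tw)
  obtain i j where ij: "n x = i" "n y = j" by blast
  have upd: "n(x := i - 1) = n(x := i - 1, y := j)" "n(y := j - 1) = n(x := i, y := j - 1)"
    using ij ne by (auto simp: fun_eq_iff)
  have sx: "shift x a n = (if i = 0 then 0 else a (n(x := i - 1, y := j)))" for a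
    by (simp only: shift_def ij upd[symmetric])
  have sy: "shift y a n = (if j = 0 then 0 else a (n(x := i, y := j - 1)))" for a
    by (simp only: shift_def ij upd[symmetric])
  have sxy: "shift x (shift y a) n = (if i = 0 \<or> j = 0 then 0 else a (n(x := i - 1, y := j - 1)))" for a
    using ij ne by (auto simp: shift_def)
  have mv: "move x y n = n(x := i - 1, y := Suc j)" "move y x n = n(x := Suc i, y := j - 1)"
    using ij ne by (auto simp: move_def Let_def tw)
  have n': "n(x := i, y := j) = n" using ij by auto
  have hn: "h n = R * fact i * fact j * B i j" "(\<Prod>v\<in>UNIV. fact (n v)) = R * fact i * (fact j :: real)"
    using h[of i j] fac[of i j] unfolding n' by blast+
  show ?thesis
    unfolding L_pair_def sxy unfolding sx sy mv h hn d2 d1 ij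
    by (cases i; cases j) (simp_all add: algebra_simps)
qed

lemma H_tensor_intertwines:
  fixes g :: "real ^ 'v::finite \<Rightarrow> real"
  assumes "real_analytic_vec g" and p0: "\<And>x. p x x = 0"
  shows "L_gen p \<sigma> \<beta> (H_tensor g) n = H_tensor (scrL_gen p \<sigma> \<beta> g) n"
proof -
  define N where "N n = (\<Prod>x\<in>UNIV. fact (n x) :: real)" for n :: "'v \<Rightarrow> nat"
  define shift where "shift x a k = (if k x = 0 then 0 else a (k(x := k x - 1)))"
    for x and a :: "('v \<Rightarrow> nat) \<Rightarrow> real" and k
  define d where "d x y a k = real (Suc (k x)) * a (incr x k) - real (Suc (k y)) * a (incr y k)"
    for x y and a :: "('v \<Rightarrow> nat) \<Rightarrow> real" and k
  obtain a where a: "has_power_series g a"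
    using real_analytic_vec_imp_power_series[OF assms(1)] .
  obtain c where "has_power_series (\<lambda>z :: real ^ 'v. exp (\<Sum>x\<in>UNIV. z $ x)) c"
    using has_power_series_exp_sum .
  hence "has_power_series (exp_sum :: real ^ 'v \<Rightarrow> real) c"
    by (simp add: exp_sum_def[abs_def])
  then obtain b where b: "has_power_series (\<lambda>z. exp_sum z * g z) b"
    using has_power_series_mult[OF _ a] by blast
  have H: "H_tensor g = (\<lambda>n. N n * b n)"
    using partials_at_0[OF b] by (simp add: H_tensor_def exp_sum_def N_def fun_eq_iff)
  define q where "q x y k = - \<beta> * (shift x (d x y b) k - shift y (d x y b) k) +
       \<sigma> * shift x (shift y (d x y (d x y b))) k" for x y k
  have pair: "has_power_series (\<lambda>z. exp_sum z * scrL_pair \<sigma> \<beta> x y g z) (q x y)" for x y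
  proof -
    obtain a' where a': "has_power_series (partial_diff x y g) a'"
      using has_power_series_partial_diff[OF a] .
    have d1: "has_power_series (\<lambda>z. exp_sum z * partial_diff x y g z) (d x y b)"
      using has_power_series_exp_sum_partial_diff[OF a b] by (simp add: d_def[abs_def])
    have d2: "has_power_series (\<lambda>z. exp_sum z * partial_diff x y (partial_diff x y g) z) (d x y (d x y b))"
      using has_power_series_exp_sum_partial_diff[OF a' d1] by (subst d_def[abs_def])
    have coord: "has_power_series (\<lambda>z. z $ v * f z) (shift v a)" if "has_power_series f a" for v f a
      using has_power_series_coord_mult[OF that, of v] by (simp add: shift_def[abs_def])
    have "has_power_series (\<lambda>z. - \<beta> * (z $ x * (exp_sum z * partial_diff x y g z) -
          z $ y * (exp_sum z * partial_diff x y g z)) +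
        \<sigma> * (z $ x * (z $ y * (exp_sum z * partial_diff x y (partial_diff x y g) z)))) (q x y)"
      unfolding q_def[abs_def]
      by (intro has_power_series_add has_power_series_cmult has_power_series_diff coord d1 d2)
    thus ?thesis
      by (simp add: scrL_pair_def algebra_simps numeral_2_eq_2)
  qed
  have "has_power_series (\<lambda>z. \<Sum>x\<in>UNIV. \<Sum>y\<in>UNIV. p x y * (exp_sum z * scrL_pair \<sigma> \<beta> x y g z))
      (\<lambda>k. \<Sum>x\<in>UNIV. \<Sum>y\<in>UNIV. p x y * q x y k)"
    by (intro has_power_series_sum has_power_series_cmult pair finite)
  hence "has_power_series (\<lambda>z. exp_sum z * scrL_gen p \<sigma> \<beta> g z)
      (\<lambda>k. \<Sum>x\<in>UNIV. \<Sum>y\<in>UNIV. p x y * q x y k)"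
    by (simp add: scrL_gen_def sum_distrib_left mult_ac)
  from partials_at_0[OF this, of n]
  have "H_tensor (scrL_gen p \<sigma> \<beta> g) n = (\<Sum>x\<in>UNIV. \<Sum>y\<in>UNIV. p x y * (N n * q x y n))"
    by (simp add: H_tensor_def exp_sum_def N_def sum_distrib_left mult_ac)
  also have "\<dots> = L_gen p \<sigma> \<beta> (H_tensor g) n"
    unfolding L_gen_def
  proof (intro sum.cong refl)
    fix x y
    show "p x y * (N n * q x y n) = p x y * L_pair \<sigma> \<beta> x y (H_tensor g) n"
    proof (cases "x = y")
      case False
      from L_pair_factorial_coeff[OF this, of \<sigma> \<beta> b n]
      show ?thesis by (simp add: H N_def q_def shift_def[abs_def] d_def[abs_def])
    qed (simp add: p0)
  qed
  finally show ?thesis by simp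
qed

theorem proposition5p2:
  fixes p :: "'v::finite \<Rightarrow> 'v \<Rightarrow> real" and \<sigma> \<beta> :: real
  assumes "\<And>x y. p x y \<ge> 0"
    and "\<And>x. p x x = 0"
    and "irreducible_rates p"
  shows "(\<forall>g. real_analytic g \<longrightarrow>
            (\<forall>z. summable (G_term (H_op g) z) \<longrightarrow> G_op (H_op g) z = g z))
       \<and> (\<forall>g. real_entire g \<longrightarrow>
            (\<forall>z. summable (G_term (H_op g) z) \<and> G_op (H_op g) z = g z))
       \<and> (\<forall>f. (\<forall>z. summable (G_term f z)) \<and> real_analytic (G_op f) \<longrightarrow>
            (\<forall>n. H_op (G_op f) n = f n))
       \<and> (\<forall>g :: real ^ 'v \<Rightarrow> real. real_analytic_vec g \<longrightarrow>
            (\<forall>n. L_gen p \<sigma> \<beta> (H_tensor g) n = H_tensor (scrL_gen p \<sigma> \<beta> g) n))"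
proof (intro conjI allI impI)
  fix g z assume "real_analytic g" "summable (G_term (H_op g) z)"
  thus "G_op (H_op g) z = g z"
    by (intro G_op_H_op real_analytic_imp_analytic_near)
next
  fix g z assume "real_entire g"
  from real_entire_sums_G_term[OF this, of z]
  show "summable (G_term (H_op g) z)" "G_op (H_op g) z = g z"
    by (simp_all add: sums_iff G_op_def)
next
  fix f n assume "(\<forall>z. summable (G_term f z)) \<and> real_analytic (G_op f)"
  thus "H_op (G_op f) n = f n" by (intro H_op_G_op) blast
next
  fix g :: "real ^ 'v \<Rightarrow> real" and n assume "real_analytic_vec g"
  thus "L_gen p \<sigma> \<beta> (H_tensor g) n = H_tensor (scrL_gen p \<sigma> \<beta> g) n"
    by (rule H_tensor_intertwines) (rule assms(2))
qed

end
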